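(* Let $L$ be a finite lattice and $\mathrm{Int}(L)=\{(x,y):x\le y\}$ its set of intervals, partially ordered by $(x,y)\le(x',y')$ iff $x\le x'$ and $y\le y'$ (a lattice under componentwise meet and join). Then for $(x,y)\le(x',y')$ in $\mathrm{Int}(L)$, $$\mu_{\mathrm{Int}(L)}((x,y),(x',y'))=\begin{cases}\mu_L(x,x')\,\mu_L(y,y'),&\text{if }x'\le y,\\ 0,&\text{otherwise.}\end{cases}$$
   Context: $\mu_L$ and $\mu_{\mathrm{Int}(L)}$ denote the Möbius functions of $L$ and $\mathrm{Int}(L)$. *)

theory Defs
  imports "HOL-Algebra.Lattice"
begin

locale finite_poset = partial_order L for L (structure) +
  assumes finite_carrier: "finite (carrier L)"
begin

text \<open>Outside the pairs \<open>x \<sqsubseteq> y\<close> of elements of the poset the function is set to \<open>0\<close>.\<close>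

function moebius :: "'a \<Rightarrow> 'a \<Rightarrow> int" where
  "moebius x y =
    (if x \<in> carrier L \<and> y \<in> carrier L \<and> x \<sqsubseteq> y then
       if x = y then 1
       else - (\<Sum>z \<in> {z \<in> carrier L. x \<sqsubseteq> z \<and> z \<sqsubset> y}. moebius x z)
     else 0)"
  by auto
termination
proof (relation "measure (\<lambda>(x, y). card {z \<in> carrier L. z \<sqsubset> y})")
  show "wf (measure (\<lambda>(x, y). card {z \<in> carrier L. z \<sqsubset> y}))" by simp
next
  fix x y z
  assume "x \<in> carrier L \<and> y \<in> carrier L \<and> x \<sqsubseteq> y"
    and "z \<in> {z \<in> carrier L. x \<sqsubseteq> z \<and> z \<sqsubset> y}"
  then have y: "y \<in> carrier L" and z: "z \<in> carrier L" "z \<sqsubset> y"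
    by auto
  have "{w \<in> carrier L. w \<sqsubset> z} \<subseteq> {w \<in> carrier L. w \<sqsubset> y}"
    using y z by (auto intro: lless_trans)
  moreover have "z \<in> {w \<in> carrier L. w \<sqsubset> y} - {w \<in> carrier L. w \<sqsubset> z}"
    using z by (simp add: lless_eq)
  ultimately have "{w \<in> carrier L. w \<sqsubset> z} \<subset> {w \<in> carrier L. w \<sqsubset> y}"
    by blast
  then show "((x, z), (x, y)) \<in> measure (\<lambda>(x, y). card {z \<in> carrier L. z \<sqsubset> y})"
    using finite_carrier by (simp add: psubset_card_mono)
qed

declare moebius.simps [simp del]

lemma moebius_refl: "x \<in> carrier L \<Longrightarrow> moebius x x = 1"
  by (simp add: moebius.simps[of x x])

lemma sum_moebius:
  assumes "x \<in> carrier L" "y \<in> carrier L" "x \<sqsubseteq> y"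
  shows "(\<Sum>z \<in> {z \<in> carrier L. x \<sqsubseteq> z \<and> z \<sqsubseteq> y}. moebius x z) = (if x = y then 1 else 0)"
proof (cases "x = y")
  case True
  then have "{z \<in> carrier L. x \<sqsubseteq> z \<and> z \<sqsubseteq> y} = {x}"
    using assms by auto
  then show ?thesis using True assms by (simp add: moebius_refl)
next
  case False
  have eq: "{z \<in> carrier L. x \<sqsubseteq> z \<and> z \<sqsubseteq> y} = insert y {z \<in> carrier L. x \<sqsubseteq> z \<and> z \<sqsubset> y}"
    using assms by (auto simp: lless_eq)
  have "moebius x y = - (\<Sum>z \<in> {z \<in> carrier L. x \<sqsubseteq> z \<and> z \<sqsubset> y}. moebius x z)"
    using assms False by (subst moebius.simps) simp
  then show ?thesis
    using False finite_carrier unfolding eq by (simp add: lless_eq)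
qed

end


definition Int_lattice :: "('a, 'b) gorder_scheme \<Rightarrow> ('a \<times> 'a) gorder" where
  "Int_lattice L =
    \<lparr> carrier = {(x, y). x \<in> carrier L \<and> y \<in> carrier L \<and> x \<sqsubseteq>\<^bsub>L\<^esub> y},
      eq = (=),
      le = (\<lambda>(x, y) (x', y'). x \<sqsubseteq>\<^bsub>L\<^esub> x' \<and> y \<sqsubseteq>\<^bsub>L\<^esub> y') \<rparr>"

lemma carrier_Int_lattice [simp]:
  "(x, y) \<in> carrier (Int_lattice L) \<longleftrightarrow> x \<in> carrier L \<and> y \<in> carrier L \<and> x \<sqsubseteq>\<^bsub>L\<^esub> y"
  by (simp add: Int_lattice_def)

lemma le_Int_lattice [simp]:
  "(x, y) \<sqsubseteq>\<^bsub>Int_lattice L\<^esub> (x', y') \<longleftrightarrow> x \<sqsubseteq>\<^bsub>L\<^esub> x' \<and> y \<sqsubseteq>\<^bsub>L\<^esub> y'"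
  by (simp add: Int_lattice_def)

lemma eq_Int_lattice [simp]: "eq (Int_lattice L) = (=)"
  by (simp add: Int_lattice_def)

lemma partial_order_Int_lattice:
  assumes "partial_order L"
  shows "partial_order (Int_lattice L)"
proof -
  interpret partial_order L by fact
  show ?thesis
    by unfold_locales (auto intro: le_trans)
qed

lemma finite_poset_Int_lattice:
  assumes "finite_poset L"
  shows "finite_poset (Int_lattice L)"
proof -
  interpret finite_poset L by fact
  interpret I: partial_order "Int_lattice L"
    by (rule partial_order_Int_lattice) unfold_locales
  have "carrier (Int_lattice L) \<subseteq> carrier L \<times> carrier L"
    by auto
  then show ?thesis
    using finite_carrier by unfold_locales (blast intro: finite_subset)
qed

context lattice
begin

lemma Int_lattice_lub:
  assumes "(x, y) \<in> carrier (Int_lattice L)" "(x', y') \<in> carrier (Int_lattice L)"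
  shows "is_lub (Int_lattice L) (x \<squnion> x', y \<squnion> y') {(x, y), (x', y')}"
proof (rule least_UpperI)
  show "(x \<squnion> x', y \<squnion> y') \<in> carrier (Int_lattice L)"
    using assms by (auto intro!: join_le intro: le_trans[OF _ join_left] le_trans[OF _ join_right])
qed (use assms in \<open>auto simp: Upper_def join_left join_right intro!: join_le; blast\<close>)+

lemma Int_lattice_glb:
  assumes "(x, y) \<in> carrier (Int_lattice L)" "(x', y') \<in> carrier (Int_lattice L)"
  shows "is_glb (Int_lattice L) (x \<sqinter> x', y \<sqinter> y') {(x, y), (x', y')}"
proof (rule greatest_LowerI)
  show "(x \<sqinter> x', y \<sqinter> y') \<in> carrier (Int_lattice L)"
    using assms by (auto intro!: meet_le intro: le_trans[OF meet_left] le_trans[OF meet_right])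
qed (use assms in \<open>auto simp: Lower_def meet_left meet_right intro!: meet_le; blast\<close>)+

lemma lattice_Int_lattice: "lattice (Int_lattice L)"
proof -
  interpret I: partial_order "Int_lattice L"
    by (rule partial_order_Int_lattice) unfold_locales
  show ?thesis
    by unfold_locales (use Int_lattice_lub Int_lattice_glb in fast)+
qed

lemma
  assumes "(x, y) \<in> carrier (Int_lattice L)" "(x', y') \<in> carrier (Int_lattice L)"
  shows join_Int_lattice: "(x, y) \<squnion>\<^bsub>Int_lattice L\<^esub> (x', y') = (x \<squnion> x', y \<squnion> y')"
    and meet_Int_lattice: "(x, y) \<sqinter>\<^bsub>Int_lattice L\<^esub> (x', y') = (x \<sqinter> x', y \<sqinter> y')"
proof -
  interpret I: partial_order "Int_lattice L"
    by (rule partial_order_Int_lattice) unfold_locales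
  show "(x, y) \<squnion>\<^bsub>Int_lattice L\<^esub> (x', y') = (x \<squnion> x', y \<squnion> y')"
    unfolding join_def[of "Int_lattice L"] sup_def
    by (rule some_equality) (use Int_lattice_lub[OF assms] I.least_unique in blast)+
  show "(x, y) \<sqinter>\<^bsub>Int_lattice L\<^esub> (x', y') = (x \<sqinter> x', y \<sqinter> y')"
    unfolding meet_def[of "Int_lattice L"] inf_def
    by (rule some_equality) (use Int_lattice_glb[OF assms] I.greatest_unique in blast)+
qed

end

lemma finite_poset_lattice:
  assumes "lattice L" "finite (carrier L)"
  shows "finite_poset L"
proof -
  interpret lattice L by fact
  show ?thesis using assms(2) by unfold_locales
qed

end

theory Submission
  imports Defs
begin

text \<open>
  The values of the Moebius function are determined by the requirement that their sums over the
  intervals \<open>[p, q]\<close> vanish unless \<open>p = q\<close>, so it suffices to sum the claimed values over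
  an interval \<open>[(x, y), (x', y')]\<close>. Only the pairs \<open>(a, b)\<close> with \<open>a \<sqsubseteq> y\<close> contribute; as \<open>y \<sqsubseteq> b\<close>,
  the constraint \<open>a \<sqsubseteq> b\<close> is then automatic, and the sum factors into the sums
  over \<open>[x, x' \<sqinter> y]\<close> and over \<open>[y, y']\<close>. If neither vanishes, then \<open>y = y'\<close>, whence
  \<open>x' \<sqsubseteq> y\<close> and \<open>x = x' \<sqinter> y = x'\<close>.
\<close>

text \<open>Induction along the recursion of \<open>moebius\<close>: both functions have the same
  sum over the interval from \<open>x\<close> to \<open>y\<close> and agree at every point of it
  strictly below \<open>y\<close>, so they agree at \<open>y\<close> as well.\<close>

lemma (in finite_poset) moebius_unique:
  assumes "x \<in> carrier L"
    and sum_g: "\<And>y. y \<in> carrier L \<Longrightarrow> x \<sqsubseteq> y \<Longrightarrow>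
      (\<Sum>z \<in> {z \<in> carrier L. x \<sqsubseteq> z \<and> z \<sqsubseteq> y}. g z) = (if x = y then 1 else 0 :: int)"
    and "y \<in> carrier L" "x \<sqsubseteq> y"
  shows "moebius x y = g y"
  using assms
proof (induction x y rule: moebius.induct)
  case (1 x y)
  let ?S = "{z \<in> carrier L. x \<sqsubseteq> z \<and> z \<sqsubset> y}"
  have split: "{z \<in> carrier L. x \<sqsubseteq> z \<and> z \<sqsubseteq> y} = insert y ?S"
    using "1.prems" by (auto simp: lless_eq)
  have sum_insert: "(\<Sum>z \<in> insert y ?S. f z) = f y + sum f ?S" for f :: "'a \<Rightarrow> int"
    using finite_carrier by (simp add: lless_eq)
  have "moebius x y + sum (moebius x) ?S = g y + sum g ?S"
    using sum_moebius[of x y] "1.prems"(2)[of y] "1.prems"(1,3,4)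
    unfolding split sum_insert by simp
  moreover have "sum (moebius x) ?S = sum g ?S"
  proof (rule sum.cong)
    fix z assume z: "z \<in> ?S"
    \<comment> \<open>The induction hypothesis comes from the recursive branch of
      \<open>moebius\<close>, which is reached only for distinct arguments.\<close>
    have "x \<noteq> y"
      using z "1.prems"(1,3) by (auto simp: lless_eq)
    then show "moebius x z = g z"
      using z "1.prems" by (intro "1.IH") auto
  qed simp
  ultimately show ?case by simp
qed

theorem theorem5p2:
  fixes L :: "('a, 'b) gorder_scheme" (structure)
  assumes "lattice L" and "finite (carrier L)"
    and "(x, y) \<in> carrier (Int_lattice L)" and "(x', y') \<in> carrier (Int_lattice L)"
    and "(x, y) \<sqsubseteq>\<^bsub>Int_lattice L\<^esub> (x', y')"
  shows "finite_poset.moebius (Int_lattice L) (x, y) (x', y') =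
    (if x' \<sqsubseteq> y then finite_poset.moebius L x x' * finite_poset.moebius L y y' else 0)"
proof -
  interpret lattice L by fact
  interpret finite_poset L
    using assms(1,2) by (rule finite_poset_lattice)
  interpret I: finite_poset "Int_lattice L"
    by (rule finite_poset_Int_lattice) unfold_locales
  have xy: "x \<in> carrier L" "y \<in> carrier L" "x \<sqsubseteq> y"
    using assms(3) by auto
  define g where "g = (\<lambda>(a, b). if a \<sqsubseteq> y then moebius x a * moebius y b else 0)"
  have sum_g: "(\<Sum>q \<in> {q \<in> carrier (Int_lattice L).
      (x, y) \<sqsubseteq>\<^bsub>Int_lattice L\<^esub> q \<and> q \<sqsubseteq>\<^bsub>Int_lattice L\<^esub> p}. g q) = (if (x, y) = p then 1 else 0)"
    (is "sum g ?S = _")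
    if p: "p \<in> carrier (Int_lattice L)" "(x, y) \<sqsubseteq>\<^bsub>Int_lattice L\<^esub> p" for p
  proof -
    obtain u v where [simp]: "p = (u, v)" by (cases p)
    have uv: "u \<in> carrier L" "v \<in> carrier L" "u \<sqsubseteq> v" "x \<sqsubseteq> u" "y \<sqsubseteq> v"
      using p by auto
    \<comment> \<open>The meet merges the bounds \<open>u\<close> and \<open>y\<close> on
      \<open>a\<close> into one, so that the first factor becomes a sum over an interval of
      \<open>L\<close>, to which \<open>sum_moebius\<close> applies.\<close>
    define m where "m = u \<sqinter> y"
    have m: "m \<in> carrier L" "m \<sqsubseteq> u" "m \<sqsubseteq> y" "x \<sqsubseteq> m"
      using xy uv unfolding m_def
      by (simp_all only: meet_closed meet_left meet_right meet_le)
    have le_m: "a \<sqsubseteq> m \<longleftrightarrow> a \<sqsubseteq> u \<and> a \<sqsubseteq> y" if "a \<in> carrier L" for a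
    proof
      show "a \<sqsubseteq> u \<and> a \<sqsubseteq> y" if "a \<sqsubseteq> m"
        using that m uv xy \<open>a \<in> carrier L\<close> le_trans[of a m] by simp
      show "a \<sqsubseteq> m" if "a \<sqsubseteq> u \<and> a \<sqsubseteq> y"
        using that uv xy \<open>a \<in> carrier L\<close> unfolding m_def by (simp only: meet_le)
    qed
    let ?A = "{a \<in> carrier L. x \<sqsubseteq> a \<and> a \<sqsubseteq> m}"
    let ?B = "{b \<in> carrier L. y \<sqsubseteq> b \<and> b \<sqsubseteq> v}"
    have "?A \<times> ?B \<subseteq> ?S"
      using xy le_m le_trans[of _ y] by auto
    \<comment> \<open>A pair of \<open>?S\<close> outside the product can only violate
      \<open>a \<sqsubseteq> y\<close>, and there \<open>g\<close> takes its default value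
      0.\<close>
    moreover have "g q = 0" if "q \<in> ?S - ?A \<times> ?B" for q
      using that by (cases q) (auto simp: g_def le_m)
    moreover have "finite ?S"
      using I.finite_carrier by simp
    ultimately have "sum g ?S = sum g (?A \<times> ?B)"
      by (intro sum.mono_neutral_right) auto
    also have "\<dots> = (\<Sum>(a, b) \<in> ?A \<times> ?B. moebius x a * moebius y b)"
      by (rule sum.cong) (auto simp: g_def le_m)
    also have "\<dots> = sum (moebius x) ?A * sum (moebius y) ?B"
      by (simp add: sum_product sum.cartesian_product)
    also have "\<dots> = (if x = m then 1 else 0) * (if y = v then 1 else 0)"
      using xy uv m by (simp add: sum_moebius)
    also have "\<dots> = (if (x, y) = p then 1 else 0)"
    proof -
      \<comment> \<open>Here \<open>u \<sqsubseteq> v = y\<close> gives \<open>m = u\<close>. For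
        \<open>y \<noteq> v\<close> both sides of the goal are 0.\<close>
      have "x = m \<longleftrightarrow> x = u" if "y = v"
        using that m uv le_m[of u] le_antisym[of m u] by auto
      then show ?thesis by (cases "y = v") simp_all
    qed
    finally show ?thesis .
  qed
  have "I.moebius (x, y) (x', y') = g (x', y')"
    using assms(3) sum_g assms(4,5) by (rule I.moebius_unique)
  then show ?thesis by (simp add: g_def)
qed

end
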